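(* Let $k=2$ and use the approximate Euclidean order index set $I=\{(v,w):0\le v,w\le 2\}\setminus\{(2,2)\}$ (8 modes). Enforce on a generic real $8\times 8$ matrix $\tilde{\mathbf Q}$ indexed by $I$ the conditions: (i) $\tilde{\mathbf Q}=\tilde{\mathbf Q}^T$; (ii) $\tilde{\mathbf Q}\tilde{\mathbf D}_x=-(\tilde{\mathbf Q}\tilde{\mathbf D}_x)^T$ and $\tilde{\mathbf Q}\tilde{\mathbf D}_y=-(\tilde{\mathbf Q}\tilde{\mathbf D}_y)^T$; (iii) $\tilde{\mathbf T}\tilde{\mathbf Q}=\tilde{\mathbf Q}\tilde{\mathbf T}$ for every rotation $\tilde{\mathbf T}$ of the reference square by a multiple of $\pi/2$. Then the matrices satisfying (i)–(iii) are precisely those of the following form, with $q_0,q_1\in\mathbb R$: $\tilde{\mathbf Q}$ is symmetric and its only nonzero entries, up to the symmetry $\tilde Q_{a,b}=\tilde Q_{b,a}$, are $$\tilde Q_{(0,1),(2,1)}=\tilde Q_{(1,0),(1,2)}=-3q_1,\quad \tilde Q_{(0,2),(2,0)}=9q_1,\quad \tilde Q_{(1,1),(1,1)}=q_1,\quad \tilde Q_{(1,2),(1,2)}=\tilde Q_{(2,1),(2,1)}=q_0 .$$ Moreover, for $\tilde{\mathbf Q}$ of this form, the remaining stability condition that $\tilde{\mathbf M}+\tilde{\mathbf Q}$ be positive definite holds if and only if $$60q_0-405q_1^2>-16\quad\text{and}\quad 2025q_1^2<16 .$$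
   Context: The reference element is $\hat K=[-1,1]^2$, and $\psi_n$ is the Legendre polynomial of degree $n$ normalised by $\psi_n(1)=1$. For a finite index set $I\subset\mathbb{N}_0^2$, the approximation space is spanned by the modes $\phi_{(v,w)}(x,y)=\psi_v(x)\psi_w(y)$, $(v,w)\in I$. Vectors and matrices are indexed by $I$, and a vector of coefficients $\tilde{\mathbf u}$ represents $\sum_{a\in I}\tilde u_a\phi_a$. The modal mass matrix is $\tilde M_{a,b}=\int_{\hat K}\phi_a\phi_b\,\mathrm{d}x\,\mathrm{d}y$. The matrices $\tilde{\mathbf D}_x,\tilde{\mathbf D}_y$ represent $\partial/\partial x,\partial/\partial y$ on coefficient vectors (the space is closed under both). The rotation matrices $\tilde{\mathbf T}$ represent, on coefficient vectors, the maps $p(x,y)\mapsto p(R(x,y))$ with $R$ the rotation by $\pi/2$, $\pi$ or $3\pi/2$ about the origin (the space is invariant under these). Conditions (i), (ii) and positive definiteness of $\tilde{\mathbf M}+\tilde{\mathbf Q}$ are the conditions on $\mathbf Q$ for linear stability, in the norm induced by $\mathbf M+\mathbf Q$, of the flux reconstruction scheme whose correction matrix is $(\mathbf M+\mathbf Q)^{-1}\mathbf L_\partial^T\mathbf W_\partial$ ($\mathbf L_\partial$: interpolation to the element boundary; $\mathbf W_\partial$: boundary mass matrix); (iii) is the requirement that the scheme be independent of the choice among the four face-relative reference frames of the square. The index set is $\{(v,w)\in\mathbb{N}_0^2:(v^p+w^p)^{1/p}\le 2\}$ with $p=48$, a slight enlargement of the Euclidean ($p=2$) basis. *)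

theory Defs
  imports "HOL-Analysis.Analysis" "HOL-Computational_Algebra.Polynomial"
begin

section \<open>Legendre modes on the reference square\<close>

text \<open>Bonnet's recursion; it fixes the normalisation to have value 1 at 1
  (lemma \<open>poly_legendre_1\<close>).\<close>

fun legendre :: "nat \<Rightarrow> real poly" where
  "legendre 0 = 1"
| "legendre (Suc 0) = [:0, 1:]"
| "legendre (Suc (Suc n)) =
     smult (1 / real (n + 2))
       (smult (real (2 * n + 3)) ([:0, 1:] * legendre (Suc n)) - smult (real (n + 1)) (legendre n))"

lemma poly_legendre_1: "poly (legendre n) 1 = 1"
  by (induction n rule: legendre.induct) (simp_all add: field_simps)

definition phi :: "nat \<times> nat \<Rightarrow> real \<times> real \<Rightarrow> real" where
  "phi = (\<lambda>(v, w) (x, y). poly (legendre v) x * poly (legendre w) y)"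

definition reference_square :: "(real \<times> real) set" where
  "reference_square = {-1..1} \<times> {-1..1}"


section \<open>The approximate Euclidean index set of order 2\<close>

text \<open>The condition \<open>(v\<^sup>p + w\<^sup>p)\<^sup>1\<^sup>/\<^sup>p \<le> 2\<close> with \<open>p = 48\<close> gives this set only up to
  rounding: for the modes (1,2) and (2,1) its left-hand side exceeds 2 by less than \<open>2 \<cdot> 10\<^sup>-\<^sup>1\<^sup>6\<close>.
  The set is therefore given by its elements.\<close>

definition approx_euclidean_2 :: "(nat \<times> nat) set" where
  "approx_euclidean_2 = {(v, w). v \<le> 2 \<and> w \<le> 2} - {(2, 2)}"

lemma approx_euclidean_2_enum:
  "approx_euclidean_2 = {(0,0), (0,1), (0,2), (1,0), (1,1), (1,2), (2,0), (2,1)}"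
proof -
  have le2: "n \<le> 2 \<longleftrightarrow> n = 0 \<or> n = 1 \<or> n = 2" for n :: nat by auto
  show ?thesis unfolding approx_euclidean_2_def le2 by auto
qed

typedef mode = approx_euclidean_2
  morphisms degrees Mode
  by (auto simp: approx_euclidean_2_enum)

lemma UNIV_mode: "(UNIV :: mode set) = Mode ` approx_euclidean_2"
  by (metis type_definition.Abs_image type_definition_mode)

instance mode :: finite
  by standard (simp add: UNIV_mode approx_euclidean_2_enum)


section \<open>Matrices indexed by the modes\<close>

definition modal_expansion :: "real ^ mode \<Rightarrow> real \<times> real \<Rightarrow> real" where
  "modal_expansion u = (\<lambda>z. \<Sum>a\<in>UNIV. u $ a * phi (degrees a) z)"

definition represents ::
    "real ^ mode ^ mode \<Rightarrow> ((real \<times> real \<Rightarrow> real) \<Rightarrow> real \<times> real \<Rightarrow> real) \<Rightarrow> bool" where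
  "represents A L \<longleftrightarrow> (\<forall>u. modal_expansion (A *v u) = L (modal_expansion u))"

definition matrix_rep ::
    "((real \<times> real \<Rightarrow> real) \<Rightarrow> real \<times> real \<Rightarrow> real) \<Rightarrow> real ^ mode ^ mode" where
  "matrix_rep L = (THE A. represents A L)"

definition mass_matrix :: "real ^ mode ^ mode" where
  "mass_matrix = (\<chi> a b. integral reference_square (\<lambda>z. phi (degrees a) z * phi (degrees b) z))"

definition partial_x :: "(real \<times> real \<Rightarrow> real) \<Rightarrow> real \<times> real \<Rightarrow> real" where
  "partial_x p = (\<lambda>(x, y). deriv (\<lambda>s. p (s, y)) x)"

definition partial_y :: "(real \<times> real \<Rightarrow> real) \<Rightarrow> real \<times> real \<Rightarrow> real" where
  "partial_y p = (\<lambda>(x, y). deriv (\<lambda>t. p (x, t)) y)"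

definition rotation :: "real \<Rightarrow> real \<times> real \<Rightarrow> real \<times> real" where
  "rotation \<theta> = (\<lambda>(x, y). (cos \<theta> * x - sin \<theta> * y, sin \<theta> * x + cos \<theta> * y))"

definition D_x :: "real ^ mode ^ mode" where
  "D_x = matrix_rep partial_x"

definition D_y :: "real ^ mode ^ mode" where
  "D_y = matrix_rep partial_y"

definition T_rot :: "real \<Rightarrow> real ^ mode ^ mode" where
  "T_rot \<theta> = matrix_rep (\<lambda>p. p \<circ> rotation \<theta>)"

definition positive_definite :: "real ^ 'n ^ 'n \<Rightarrow> bool" where
  "positive_definite A \<longleftrightarrow> transpose A = A \<and> (\<forall>u. u \<noteq> 0 \<longrightarrow> 0 < u \<bullet> (A *v u))"


subsection \<open>Well-definedness of the representing matrices\<close>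

lemma sum_mode:
  "(\<Sum>a\<in>UNIV. f a) =
     f (Mode (0,0)) + f (Mode (0,1)) + f (Mode (0,2)) + f (Mode (1,0)) + f (Mode (1,1))
     + f (Mode (1,2)) + f (Mode (2,0)) + (f (Mode (2,1)) :: 'b :: comm_monoid_add)"
proof -
  have "inj_on Mode approx_euclidean_2"
    by (simp add: inj_on_def Mode_inject)
  hence "(\<Sum>a\<in>UNIV. f a) = (\<Sum>s\<in>approx_euclidean_2. f (Mode s))"
    by (simp add: UNIV_mode sum.reindex)
  thus ?thesis
    by (simp add: approx_euclidean_2_enum add.assoc)
qed

lemma all_mode:
  "(\<forall>a. P a) \<longleftrightarrow>
     P (Mode (0,0)) \<and> P (Mode (0,1)) \<and> P (Mode (0,2)) \<and> P (Mode (1,0)) \<and> P (Mode (1,1))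
     \<and> P (Mode (1,2)) \<and> P (Mode (2,0)) \<and> P (Mode (2,1))"
proof -
  have "(\<forall>a. P a) \<longleftrightarrow> (\<forall>a\<in>UNIV. P a)" by simp
  thus ?thesis by (simp add: UNIV_mode approx_euclidean_2_enum)
qed

lemma degrees_Mode [simp]:
  "degrees (Mode (0,0)) = (0,0)" "degrees (Mode (0,Suc 0)) = (0,1)" "degrees (Mode (0,2)) = (0,2)"
  "degrees (Mode (Suc 0,0)) = (1,0)" "degrees (Mode (Suc 0,Suc 0)) = (1,1)"
  "degrees (Mode (Suc 0,2)) = (1,2)" "degrees (Mode (2,0)) = (2,0)"
  "degrees (Mode (2,Suc 0)) = (2,1)"
  by (simp_all add: Mode_inverse approx_euclidean_2_enum)

lemma poly_legendre:
  "poly (legendre 0) x = 1" "poly (legendre (Suc 0)) x = x"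
  "poly (legendre 2) x = (3 * x\<^sup>2 - 1) / 2"
  by (simp_all add: numeral_2_eq_2 power2_eq_square field_simps)

lemmas modal_expansion_simps =
  modal_expansion_def sum_mode phi_def poly_legendre

lemma modal_expansion_inject: "modal_expansion u = modal_expansion u' \<longleftrightarrow> u = u'"
proof
  assume eq: "modal_expansion u = modal_expansion u'"
  define d where "d = u - u'"
  have z: "modal_expansion d (x, y) = 0" for x y
    using fun_cong[OF eq, of "(x, y)"]
    by (simp add: d_def modal_expansion_def left_diff_distrib sum_subtractf)
  have "d $ a = 0" for a
    using z[of 0 0] z[of 0 1] z[of 0 "-1"] z[of 1 0] z[of 1 1] z[of 1 "-1"]
      z[of "-1" 0] z[of "-1" 1] z[of "-1" "-1"]
    using all_mode[of "\<lambda>a. d $ a = 0"]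
    by (simp add: modal_expansion_simps)
  thus "u = u'" by (simp add: d_def vec_eq_iff)
qed simp

lemma represents_unique: "represents A L \<Longrightarrow> represents B L \<Longrightarrow> A = B"
  unfolding represents_def by (metis modal_expansion_inject matrix_eq)

lemma matrix_rep_eqI: "represents A L \<Longrightarrow> matrix_rep L = A"
  unfolding matrix_rep_def using represents_unique by blast


lemma ex_represents_partial_x: "\<exists>A. represents A partial_x"
proof
  let ?A = "\<chi> a b. (if snd (degrees a) = snd (degrees b) \<and> fst (degrees b) = Suc (fst (degrees a))
     then 2 * real (fst (degrees a)) + 1 else 0)"
  show "represents ?A partial_x"
    unfolding represents_def
  proof (intro allI ext, clarify)
    fix u x y
    have "((\<lambda>s. modal_expansion u (s, y)) has_field_derivative
        modal_expansion (?A *v u) (x, y)) (at x)"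
      unfolding modal_expansion_simps
      by (auto intro!: derivative_eq_intros
          simp: matrix_vector_mult_def modal_expansion_simps field_simps power2_eq_square)
    thus "modal_expansion (?A *v u) (x, y) = partial_x (modal_expansion u) (x, y)"
      by (simp add: partial_x_def DERIV_imp_deriv)
  qed
qed

lemma ex_represents_partial_y: "\<exists>A. represents A partial_y"
proof
  let ?A = "\<chi> a b. (if fst (degrees a) = fst (degrees b) \<and> snd (degrees b) = Suc (snd (degrees a))
     then 2 * real (snd (degrees a)) + 1 else 0)"
  show "represents ?A partial_y"
    unfolding represents_def
  proof (intro allI ext, clarify)
    fix u x y
    have "((\<lambda>t. modal_expansion u (x, t)) has_field_derivative
        modal_expansion (?A *v u) (x, y)) (at y)"
      unfolding modal_expansion_simps
      by (auto intro!: derivative_eq_intros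
          simp: matrix_vector_mult_def modal_expansion_simps field_simps power2_eq_square)
    thus "modal_expansion (?A *v u) (x, y) = partial_y (modal_expansion u) (x, y)"
      by (simp add: partial_y_def DERIV_imp_deriv)
  qed
qed

lemma represents_compose:
  assumes "represents A (\<lambda>p. p \<circ> f)" "represents B (\<lambda>p. p \<circ> g)"
  shows "represents (A ** B) (\<lambda>p. p \<circ> (g \<circ> f))"
  using assms by (simp add: represents_def comp_assoc flip: matrix_vector_mul_assoc)

lemma rotation_add: "rotation \<alpha> \<circ> rotation \<beta> = rotation (\<alpha> + \<beta>)"
  by (auto simp: rotation_def cos_add sin_add algebra_simps)

lemma ex_represents_rotation:
  "\<exists>A. represents A (\<lambda>p. p \<circ> rotation (real_of_int j * (pi / 2)))"
proof -
  let ?Q = "\<lambda>s. \<chi> a b. (if degrees a = prod.swap (degrees b)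
     then s ^ fst (degrees b) * (- s) ^ snd (degrees b) else 0 :: real)"
  have rot: "rotation (pi / 2) = (\<lambda>(x, y). (- y, x))" "rotation (- pi / 2) = (\<lambda>(x, y). (y, - x))"
    by (simp_all add: rotation_def)
  have pos: "represents (?Q (-1)) (\<lambda>p. p \<circ> rotation (pi / 2))"
    and neg: "represents (?Q 1) (\<lambda>p. p \<circ> rotation (- pi / 2))"
    unfolding represents_def rot
    by (auto simp: fun_eq_iff matrix_vector_mult_def modal_expansion_simps algebra_simps)
      (simp_all add: field_simps)
  show ?thesis
  proof (induction j rule: int_induct[where k = 0])
    case base
    have "represents (mat 1) (\<lambda>p. p \<circ> rotation 0)"
      by (auto simp: represents_def rotation_def fun_eq_iff)
    thus ?case unfolding of_int_0 mult_zero_left by blast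
  next
    case (step1 i)
    then obtain A where "represents A (\<lambda>p. p \<circ> rotation (real_of_int i * (pi / 2)))" by blast
    note represents_compose[OF this pos, unfolded rotation_add]
    moreover have "pi / 2 + real_of_int i * (pi / 2) = real_of_int (i + 1) * (pi / 2)"
      by (simp add: field_simps)
    ultimately show ?case by metis
  next
    case (step2 i)
    then obtain A where "represents A (\<lambda>p. p \<circ> rotation (real_of_int i * (pi / 2)))" by blast
    note represents_compose[OF this neg, unfolded rotation_add]
    moreover have "- pi / 2 + real_of_int i * (pi / 2) = real_of_int (i - 1) * (pi / 2)"
      by (simp add: field_simps)
    ultimately show ?case by metis
  qed
qed

lemma represents_matrix_rep: "\<exists>A. represents A L \<Longrightarrow> represents (matrix_rep L) L"
  using matrix_rep_eqI by auto

lemmas represents_D_x = represents_matrix_rep[OF ex_represents_partial_x, folded D_x_def]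
  and represents_D_y = represents_matrix_rep[OF ex_represents_partial_y, folded D_y_def]
  and represents_T_rot = represents_matrix_rep[OF ex_represents_rotation, folded T_rot_def]


section \<open>The two-parameter family\<close>

text \<open>Comparing the unordered pair of indices builds in the symmetry.\<close>

definition Q_form :: "real \<Rightarrow> real \<Rightarrow> real ^ mode ^ mode" where
  "Q_form q\<^sub>0 q\<^sub>1 = (\<chi> a b.
     let ab = {degrees a, degrees b} in
     if ab = {(0,1), (2,1)} \<or> ab = {(1,0), (1,2)} then - 3 * q\<^sub>1
     else if ab = {(0,2), (2,0)} then 9 * q\<^sub>1
     else if ab = {(1,1)} then q\<^sub>1
     else if ab = {(1,2)} \<or> ab = {(2,1)} then q\<^sub>0
     else 0)"

end

theory Submission
  imports Defs
begin

text \<open>Rotation by a quarter turn sends mode (v,w) to (-1)^v (w,v), so commuting with it relates the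
  entries of \<open>Q\<close> at (a,b) and at the swapped modes, and kills those between modes of opposite parity
  of v + w. \<open>D_x\<close> maps (1,w) to (0,w) and (2,w) to 3 (1,w); comparing entries of the antisymmetric
  matrices \<open>Q D_x\<close> and \<open>Q D_y\<close> leaves only the stated family. The mass matrix is diagonal, so \<open>M + Q\<close>
  splits into two equal blocks on (0,1), (2,1) and on (1,0), (1,2), a block on (0,2), (2,0), and the
  modes (0,0) and (1,1); positivity at (1,1) follows from that of the block on (0,2), (2,0).\<close>

section \<open>Derivative and rotation matrices in the modal basis\<close>

text \<open>In general \<psi>_n' is the sum of (2k+1) \<psi>_k over k = n-1, n-3, ...; up to degree
  2 only k = n-1 occurs, which leaves at most one nonzero entry per column.\<close>

lemma D_x_eq:
  "D_x = (\<chi> a b. if snd (degrees a) = snd (degrees b) \<and> fst (degrees b) = Suc (fst (degrees a))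
     then 2 * real (fst (degrees a)) + 1 else 0)" (is "_ = ?A")
  unfolding D_x_def
proof (rule matrix_rep_eqI, unfold represents_def, intro allI ext, clarify)
  fix u x y
  have "((\<lambda>s. modal_expansion u (s, y)) has_field_derivative
      modal_expansion (?A *v u) (x, y)) (at x)"
    unfolding modal_expansion_simps
    by (auto intro!: derivative_eq_intros
        simp: matrix_vector_mult_def modal_expansion_simps field_simps power2_eq_square)
  thus "modal_expansion (?A *v u) (x, y) = partial_x (modal_expansion u) (x, y)"
    by (simp add: partial_x_def DERIV_imp_deriv)
qed

lemma D_y_eq:
  "D_y = (\<chi> a b. if fst (degrees a) = fst (degrees b) \<and> snd (degrees b) = Suc (snd (degrees a))
     then 2 * real (snd (degrees a)) + 1 else 0)" (is "_ = ?A")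
  unfolding D_y_def
proof (rule matrix_rep_eqI, unfold represents_def, intro allI ext, clarify)
  fix u x y
  have "((\<lambda>t. modal_expansion u (x, t)) has_field_derivative
      modal_expansion (?A *v u) (x, y)) (at y)"
    unfolding modal_expansion_simps
    by (auto intro!: derivative_eq_intros
        simp: matrix_vector_mult_def modal_expansion_simps field_simps power2_eq_square)
  thus "modal_expansion (?A *v u) (x, y) = partial_y (modal_expansion u) (x, y)"
    by (simp add: partial_y_def DERIV_imp_deriv)
qed

text \<open>A Legendre polynomial has the parity of its degree, so composing mode (v,w) with (x,y)
  \<mapsto> (-y,x) swaps its factors at the cost of the sign (-1)^v.\<close>

lemma T_rot_quarter:
  "T_rot (pi / 2) = (\<chi> a b. if degrees a = prod.swap (degrees b)
     then (-1) ^ fst (degrees b) else 0)"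
proof -
  have rot: "rotation (pi / 2) = (\<lambda>(x, y). (- y, x))"
    by (simp add: rotation_def)
  show ?thesis
    unfolding T_rot_def
    by (rule matrix_rep_eqI, unfold represents_def rot)
      (auto simp: fun_eq_iff matrix_vector_mult_def modal_expansion_simps field_simps)
qed

lemma T_rot_0: "T_rot 0 = mat 1"
  unfolding T_rot_def
  by (rule matrix_rep_eqI) (auto simp: represents_def rotation_def fun_eq_iff)

lemma T_rot_add_quarter:
  "T_rot (real_of_int (j + 1) * (pi / 2)) = T_rot (real_of_int j * (pi / 2)) ** T_rot (pi / 2)"
proof -
  have "represents (T_rot (real_of_int j * (pi / 2)) ** T_rot (pi / 2))
      (\<lambda>p. p \<circ> rotation (pi / 2 + real_of_int j * (pi / 2)))"
    using represents_compose[OF represents_T_rot[of j] represents_T_rot[of 1]]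
    by (simp add: rotation_add)
  moreover have "pi / 2 + real_of_int j * (pi / 2) = real_of_int (j + 1) * (pi / 2)"
    by (simp add: field_simps)
  ultimately show ?thesis
    unfolding T_rot_def[of "real_of_int (j + 1) * (pi / 2)"] by (metis matrix_rep_eqI)
qed

text \<open>Reduces condition (iii) to the quarter turn: the matrices commuting with
  \<open>Q\<close> are closed under products and inverses, and the quarter turn generates all the
  rotations.\<close>

lemma T_rot_commute_all:
  assumes "T_rot (pi / 2) ** Q = Q ** T_rot (pi / 2)"
  shows "T_rot (real_of_int j * (pi / 2)) ** Q = Q ** T_rot (real_of_int j * (pi / 2))"
proof (induction j rule: int_induct[where k = 0])
  case base
  show ?case by (simp add: T_rot_0)
next
  case (step1 i)
  thus ?case
    unfolding T_rot_add_quarter by (metis assms matrix_mul_assoc)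
next
  case (step2 i)
  let ?T = "T_rot (pi / 2)" and ?S = "T_rot (real_of_int (i - 1) * (pi / 2))"
  \<comment> \<open>The turn by -pi/2 is a left inverse of \<open>?T\<close>, hence also a right
    inverse; it serves to cancel \<open>?T\<close> on the right in the downward induction
    step.\<close>
  have inv: "?T ** T_rot (real_of_int (-1) * (pi / 2)) = mat 1"
    using T_rot_add_quarter[of "-1"] by (subst matrix_left_right_inverse) (simp add: T_rot_0)
  have "?S ** Q ** ?T = Q ** ?S ** ?T"
    using step2 T_rot_add_quarter[of "i - 1"] assms by (metis diff_add_cancel matrix_mul_assoc)
  hence "?S ** Q ** (?T ** T_rot (real_of_int (-1) * (pi / 2)))
      = Q ** ?S ** (?T ** T_rot (real_of_int (-1) * (pi / 2)))"
    by (simp only: matrix_mul_assoc)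
  thus ?case unfolding inv by simp
qed

section \<open>Legendre orthogonality and the mass matrix\<close>

lemma integral_poly4:
  "integral {-1..1} (\<lambda>x::real. c0 + c1 * x + c2 * x^2 + c3 * x^3 + c4 * x^4)
     = 2 * c0 + 2 * c2 / 3 + 2 * c4 / 5"
proof -
  let ?F = "\<lambda>x::real. c0 * x + c1 * x^2 / 2 + c2 * x^3 / 3 + c3 * x^4 / 4 + c4 * x^5 / 5"
  have "((\<lambda>x::real. c0 + c1 * x + c2 * x^2 + c3 * x^3 + c4 * x^4)
      has_integral (?F 1 - ?F (-1))) {-1..1}"
    by (rule fundamental_theorem_of_calculus)
      (auto simp flip: has_real_derivative_iff_has_vector_derivative
        intro!: derivative_eq_intros)
  thus ?thesis by (simp add: integral_unique)
qed

lemma legendre_orthogonal: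
  assumes "v \<le> 2" "w \<le> 2"
  shows "integral {-1..1} (\<lambda>x. poly (legendre v) x * poly (legendre w) x)
    = (if v = w then 2 / (2 * real v + 1) else 0)"
proof -
  have cases: "n = 0 \<or> n = Suc 0 \<or> n = 2" if "n \<le> 2" for n :: nat
    using that by auto
  show ?thesis
    using cases[OF assms(1)] cases[OF assms(2)]
      \<comment> \<open>Coefficients of the products 1, x, \<psi>_2, x^2, x \<psi>_2 and \<psi>_2^2,
        in this order.\<close>
      integral_poly4[of 1 0 0 0 0] integral_poly4[of 0 1 0 0 0] integral_poly4[of "-1/2" 0 "3/2" 0 0]
      integral_poly4[of 0 0 1 0 0] integral_poly4[of 0 "-1/2" 0 "3/2" 0]
      integral_poly4[of "1/4" 0 "-6/4" 0 "9/4"]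
    by (elim disjE)
       (simp_all add: poly_legendre power2_eq_square power3_eq_cube power4_eq_xxxx
         algebra_simps diff_divide_distrib add_divide_distrib)
qed

lemma reference_square_eq_cbox: "reference_square = cbox (-1, -1) (1, 1)"
  by (simp add: reference_square_def cbox_Pair_eq)

lemma degrees_le_2: "fst (degrees a) \<le> 2" "snd (degrees a) \<le> 2"
  using degrees[of a] by (auto simp: approx_euclidean_2_def)

text \<open>By Fubini the integral of a product of modes factors into two one-dimensional integrals,
  to which orthogonality applies.\<close>

lemma mass_matrix_eq:
  "mass_matrix = (\<chi> a b. if degrees a = degrees b
     then 4 / ((2 * real (fst (degrees a)) + 1) * (2 * real (snd (degrees a)) + 1)) else 0)"
proof -
  have "integral reference_square (\<lambda>z. phi (degrees a) z * phi (degrees b) z)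
     = (if degrees a = degrees b
        then 4 / ((2 * real (fst (degrees a)) + 1) * (2 * real (snd (degrees a)) + 1)) else 0)"
    for a b
  proof -
    obtain v w v' w' where ab: "degrees a = (v, w)" "degrees b = (v', w')"
      by (metis surj_pair)
    have le: "v \<le> 2" "w \<le> 2" "v' \<le> 2" "w' \<le> 2"
      using degrees_le_2[of a] degrees_le_2[of b] ab by auto
    let ?X = "\<lambda>x. poly (legendre v) x * poly (legendre v') x"
    let ?Y = "\<lambda>y. poly (legendre w) y * poly (legendre w') y"
    have "integral (cbox (-1, -1) (1, 1)) (\<lambda>z. phi (degrees a) z * phi (degrees b) z)
        = integral (cbox (-1) 1) (\<lambda>x. integral (cbox (-1) 1)
            (\<lambda>y. phi (degrees a) (x, y) * phi (degrees b) (x, y)))"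
      by (rule integral_prod_continuous)
        (auto simp: phi_def ab case_prod_beta intro!: continuous_intros)
    also have "\<dots> = integral {-1..1} (\<lambda>x. integral {-1..1} (\<lambda>y. ?X x * ?Y y))"
      by (simp add: phi_def ab mult_ac)
    also have "\<dots> = integral {-1..1} ?X * integral {-1..1} ?Y"
      by simp
    also have "\<dots> = (if degrees a = degrees b
        then 4 / ((2 * real (fst (degrees a)) + 1) * (2 * real (snd (degrees a)) + 1)) else 0)"
      using le by (simp add: legendre_orthogonal ab)
    finally show ?thesis unfolding reference_square_eq_cbox .
  qed
  thus ?thesis by (simp add: mass_matrix_def vec_eq_iff)
qed

section \<open>Solving the linear conditions on \<open>Q\<close> entry by entry\<close>

text \<open>The x-derivative of a mode is a multiple of a single mode or zero, so each column of the
  product is a multiple of one column of \<open>Q\<close> or zero. This turns antisymmetry into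
  relations between pairs of entries of \<open>Q\<close>.\<close>

lemma mult_D_x_column:
  fixes Q :: "real ^ mode ^ mode"
  shows
  "(Q ** D_x) $ a $ Mode (0,0) = 0"
  "(Q ** D_x) $ a $ Mode (0,Suc 0) = 0"
  "(Q ** D_x) $ a $ Mode (0,2) = 0"
  "(Q ** D_x) $ a $ Mode (Suc 0,0) = Q $ a $ Mode (0,0)"
  "(Q ** D_x) $ a $ Mode (Suc 0,Suc 0) = Q $ a $ Mode (0,Suc 0)"
  "(Q ** D_x) $ a $ Mode (Suc 0,2) = Q $ a $ Mode (0,2)"
  "(Q ** D_x) $ a $ Mode (2,0) = 3 * Q $ a $ Mode (Suc 0,0)"
  "(Q ** D_x) $ a $ Mode (2,Suc 0) = 3 * Q $ a $ Mode (Suc 0,Suc 0)"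
  by (simp_all add: matrix_matrix_mult_def D_x_eq sum_mode)

lemma mult_D_y_column:
  fixes Q :: "real ^ mode ^ mode"
  shows
  "(Q ** D_y) $ a $ Mode (0,0) = 0"
  "(Q ** D_y) $ a $ Mode (0,Suc 0) = Q $ a $ Mode (0,0)"
  "(Q ** D_y) $ a $ Mode (0,2) = 3 * Q $ a $ Mode (0,Suc 0)"
  "(Q ** D_y) $ a $ Mode (Suc 0,0) = 0"
  "(Q ** D_y) $ a $ Mode (Suc 0,Suc 0) = Q $ a $ Mode (Suc 0,0)"
  "(Q ** D_y) $ a $ Mode (Suc 0,2) = 3 * Q $ a $ Mode (Suc 0,Suc 0)"
  "(Q ** D_y) $ a $ Mode (2,0) = 0"
  "(Q ** D_y) $ a $ Mode (2,Suc 0) = Q $ a $ Mode (2,0)"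
  by (simp_all add: matrix_matrix_mult_def D_y_eq sum_mode)

lemma swap_mode: "prod.swap (degrees a) \<in> approx_euclidean_2"
  using degrees[of a] by (auto simp: approx_euclidean_2_def)

lemma T_rot_quarter_commute_entry:
  fixes Q :: "real ^ mode ^ mode"
  assumes "T_rot (pi / 2) ** Q = Q ** T_rot (pi / 2)"
  shows "Q $ a $ b = (-1) ^ (fst (degrees a) + fst (degrees b))
    * Q $ Mode (prod.swap (degrees a)) $ Mode (prod.swap (degrees b))"
proof -
  let ?\<sigma> = "\<lambda>a. Mode (prod.swap (degrees a))"
  have iff: "degrees c = prod.swap (degrees d) \<longleftrightarrow> c = ?\<sigma> d"
    "degrees d = prod.swap (degrees c) \<longleftrightarrow> c = ?\<sigma> d" for c d
    by (metis Mode_inverse degrees_inverse swap_mode swap_swap)+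
  \<comment> \<open>The quarter turn is a signed permutation matrix: in each of the two products a
    single summand survives, at index \<open>a\<close> here and at \<open>?\<sigma> b\<close>
    below.\<close>
  have "(T_rot (pi / 2) ** Q) $ ?\<sigma> a $ b = (-1) ^ fst (degrees a) * Q $ a $ b"
    by (simp add: matrix_matrix_mult_def T_rot_quarter Mode_inverse swap_mode degrees_inject inj_eq[OF inj_swap]
        if_distrib[of "\<lambda>x. x * _"] cong: if_cong)
  moreover have "(Q ** T_rot (pi / 2)) $ ?\<sigma> a $ b = (-1) ^ fst (degrees b) * Q $ ?\<sigma> a $ ?\<sigma> b"
    by (simp add: matrix_matrix_mult_def T_rot_quarter iff
        if_distrib[of "\<lambda>x. _ * x"] cong: if_cong)
  ultimately have eq: "(-1) ^ fst (degrees a) * Q $ a $ b = (-1) ^ fst (degrees b) * Q $ ?\<sigma> a $ ?\<sigma> b"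
    using assms by simp
  have "Q $ a $ b = (-1) ^ fst (degrees a) * ((-1) ^ fst (degrees a) * Q $ a $ b)"
    by (simp flip: power_add mult.assoc)
  thus ?thesis unfolding eq by (simp add: power_add)
qed

lemma ex_Q_form:
  fixes Q :: "real ^ mode ^ mode"
  assumes sym: "Q = transpose Q"
    and x: "Q ** D_x = - transpose (Q ** D_x)"
    and y: "Q ** D_y = - transpose (Q ** D_y)"
    and T: "T_rot (pi / 2) ** Q = Q ** T_rot (pi / 2)"
  shows "\<exists>q\<^sub>0 q\<^sub>1. Q = Q_form q\<^sub>0 q\<^sub>1"
proof -
  have S: "Q $ a $ b = Q $ b $ a" for a b
    using sym by (metis transpose_def vec_lambda_beta)
  have X: "(Q ** D_x) $ a $ b = - (Q ** D_x) $ b $ a" for a b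
    by (subst x) (simp add: transpose_def)
  have Y: "(Q ** D_y) $ a $ b = - (Q ** D_y) $ b $ a" for a b
    by (subst y) (simp add: transpose_def)
  note T' = T_rot_quarter_commute_entry[OF T]
  define q\<^sub>0 where "q\<^sub>0 = Q $ Mode (1,2) $ Mode (1,2)"
  define q\<^sub>1 where "q\<^sub>1 = Q $ Mode (1,1) $ Mode (1,1)"
  \<comment> \<open>The columns of \<open>Q ** D_x\<close> at modes (0,w) vanish, so by antisymmetry
    the rows there vanish as well, and these rows consist of multiples of entries of
    \<open>Q\<close>.\<close>
  have x_entries:
    "Q $ Mode (0,0) $ Mode (0,0) = 0"
    "Q $ Mode (0,0) $ Mode (0,1) = 0"
    "Q $ Mode (0,0) $ Mode (0,2) = 0"
    "Q $ Mode (0,1) $ Mode (0,1) = 0"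
    "Q $ Mode (0,1) $ Mode (0,2) = 0"
    "Q $ Mode (0,2) $ Mode (0,2) = 0"
    "Q $ Mode (0,0) $ Mode (1,1) = 0"
    "Q $ Mode (0,1) $ Mode (1,0) = 0"
    "Q $ Mode (0,1) $ Mode (1,1) = 0"
    "Q $ Mode (0,2) $ Mode (1,1) = 0"
    using X[of "Mode (0,0)" "Mode (1,0)"]
      X[of "Mode (0,0)" "Mode (1,1)"]
      X[of "Mode (0,0)" "Mode (1,2)"]
      X[of "Mode (0,1)" "Mode (1,1)"]
      X[of "Mode (0,1)" "Mode (1,2)"]
      X[of "Mode (0,2)" "Mode (1,2)"]
      X[of "Mode (0,0)" "Mode (2,1)"]
      X[of "Mode (0,1)" "Mode (2,0)"]
      X[of "Mode (0,1)" "Mode (2,1)"]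
      X[of "Mode (0,2)" "Mode (2,1)"]
    by (simp_all add: mult_D_x_column mult_D_y_column)
  \<comment> \<open>The same argument for \<open>Q ** D_y\<close> at modes (v,0).\<close>
  have y_entries:
    "Q $ Mode (0,0) $ Mode (1,0) = 0"
    "Q $ Mode (0,0) $ Mode (2,0) = 0"
    "Q $ Mode (1,0) $ Mode (1,0) = 0"
    "Q $ Mode (1,0) $ Mode (2,0) = 0"
    "Q $ Mode (2,0) $ Mode (2,0) = 0"
    "Q $ Mode (1,0) $ Mode (1,1) = 0"
    "Q $ Mode (1,1) $ Mode (2,0) = 0"
    using Y[of "Mode (0,0)" "Mode (1,1)"]
      Y[of "Mode (0,0)" "Mode (2,1)"]
      Y[of "Mode (1,0)" "Mode (1,1)"]
      Y[of "Mode (1,0)" "Mode (2,1)"]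
      Y[of "Mode (2,0)" "Mode (2,1)"]
      Y[of "Mode (1,0)" "Mode (1,2)"]
      Y[of "Mode (2,0)" "Mode (1,2)"]
      S[of "Mode (1,1)" "Mode (2,0)"]
    by (simp_all add: mult_D_x_column mult_D_y_column)
  \<comment> \<open>Two quarter turns bring back the same entry with sign (-1)^(v+w+v'+w'), which is
    -1 for modes of opposite parity. For (1,2), (2,1) one turn already gives the transposed entry
    with sign -1, so symmetry makes it vanish.\<close>
  have t_entries:
    "Q $ Mode (0,0) $ Mode (1,2) = 0"
    "Q $ Mode (0,0) $ Mode (2,1) = 0"
    "Q $ Mode (0,1) $ Mode (2,0) = 0"
    "Q $ Mode (0,2) $ Mode (1,0) = 0"
    "Q $ Mode (0,2) $ Mode (1,2) = 0"
    "Q $ Mode (2,0) $ Mode (2,1) = 0"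
    "Q $ Mode (0,2) $ Mode (2,1) = 0"
    "Q $ Mode (1,2) $ Mode (2,0) = 0"
    "Q $ Mode (1,1) $ Mode (1,2) = 0"
    "Q $ Mode (1,1) $ Mode (2,1) = 0"
    "Q $ Mode (1,2) $ Mode (2,1) = 0"
    using T'[of "Mode (0,0)" "Mode (1,2)"]
      T'[of "Mode (0,0)" "Mode (2,1)"]
      T'[of "Mode (0,1)" "Mode (2,0)"]
      T'[of "Mode (1,0)" "Mode (0,2)"]
      S[of "Mode (1,0)" "Mode (0,2)"]
      T'[of "Mode (0,2)" "Mode (1,2)"]
      T'[of "Mode (2,0)" "Mode (2,1)"]
      T'[of "Mode (0,2)" "Mode (2,1)"]
      T'[of "Mode (2,0)" "Mode (1,2)"]
      S[of "Mode (2,0)" "Mode (1,2)"]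
      T'[of "Mode (1,1)" "Mode (1,2)"]
      T'[of "Mode (1,1)" "Mode (2,1)"]
      T'[of "Mode (1,2)" "Mode (2,1)"]
      S[of "Mode (1,2)" "Mode (2,1)"]
    by (simp_all add: mult_D_x_column mult_D_y_column)
  \<comment> \<open>Antisymmetry links the (1,1) diagonal entry to the pairs (0,1), (2,1) and (1,0),
    (1,2) with factor -3, and the latter to (0,2), (2,0) with a further factor -3. No derivative of
    a mode in the index set involves (1,2) or (2,1), so their diagonal entries stay free apart from
    being equated by the rotation.\<close>
  have d_entries:
    "Q $ Mode (0,1) $ Mode (1,2) = 0"
    "Q $ Mode (1,0) $ Mode (2,1) = 0"
    "Q $ Mode (0,1) $ Mode (2,1) = - 3 * q\<^sub>1"
    "Q $ Mode (1,0) $ Mode (1,2) = - 3 * q\<^sub>1"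
    "Q $ Mode (0,2) $ Mode (2,0) = 9 * q\<^sub>1"
    "Q $ Mode (1,1) $ Mode (1,1) = q\<^sub>1"
    "Q $ Mode (1,2) $ Mode (1,2) = q\<^sub>0"
    "Q $ Mode (2,1) $ Mode (2,1) = q\<^sub>0"
    using x_entries(10) y_entries(7) q\<^sub>0_def q\<^sub>1_def
      X[of "Mode (1,1)" "Mode (1,2)"]
      Y[of "Mode (1,1)" "Mode (2,1)"]
      X[of "Mode (1,1)" "Mode (2,1)"]
      Y[of "Mode (1,1)" "Mode (1,2)"]
      X[of "Mode (1,2)" "Mode (2,0)"]
      S[of "Mode (0,2)" "Mode (1,1)"]
      S[of "Mode (0,1)" "Mode (1,2)"]
      S[of "Mode (1,0)" "Mode (2,1)"]
      S[of "Mode (0,1)" "Mode (2,1)"]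
      S[of "Mode (1,0)" "Mode (1,2)"]
      S[of "Mode (0,2)" "Mode (2,0)"]
      T'[of "Mode (1,2)" "Mode (1,2)"]
    by (simp_all add: mult_D_x_column mult_D_y_column)
  \<comment> \<open>These are all 36 entries on or above the diagonal in lexicographic order;
    \<open>S\<close> supplies the rest.\<close>
  note upper = x_entries[unfolded One_nat_def] y_entries[unfolded One_nat_def]
    t_entries[unfolded One_nat_def] d_entries[unfolded One_nat_def]
  have "Q = Q_form q\<^sub>0 q\<^sub>1"
    unfolding vec_eq_iff all_mode
    by (simp add: upper upper[THEN trans[OF S]] Q_form_def doubleton_eq_iff)
  thus ?thesis by blast
qed

lemma Q_form_conditions:
  "Q_form q\<^sub>0 q\<^sub>1 = transpose (Q_form q\<^sub>0 q\<^sub>1)"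
  "Q_form q\<^sub>0 q\<^sub>1 ** D_x = - transpose (Q_form q\<^sub>0 q\<^sub>1 ** D_x)"
  "Q_form q\<^sub>0 q\<^sub>1 ** D_y = - transpose (Q_form q\<^sub>0 q\<^sub>1 ** D_y)"
  "T_rot (pi / 2) ** Q_form q\<^sub>0 q\<^sub>1 = Q_form q\<^sub>0 q\<^sub>1 ** T_rot (pi / 2)"
proof -
  let ?Q = "Q_form q\<^sub>0 q\<^sub>1"
  show "?Q = transpose ?Q"
    by (simp add: vec_eq_iff transpose_def Q_form_def insert_commute)
  show "?Q ** D_x = - transpose (?Q ** D_x)"
    unfolding vec_eq_iff all_mode transpose_def
    by (simp add: mult_D_x_column) (simp add: Q_form_def doubleton_eq_iff)
  show "?Q ** D_y = - transpose (?Q ** D_y)"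
    unfolding vec_eq_iff all_mode transpose_def
    by (simp add: mult_D_y_column) (simp add: Q_form_def doubleton_eq_iff)
  show "T_rot (pi / 2) ** ?Q = ?Q ** T_rot (pi / 2)"
    unfolding vec_eq_iff all_mode
    by (simp add: matrix_matrix_mult_def T_rot_quarter sum_mode)
      (simp add: Q_form_def doubleton_eq_iff)
qed

section \<open>Positive definiteness of the mass matrix plus \<open>Q_form\<close>\<close>

text \<open>Complete the square after multiplying by \<open>p\<close>. The weak inequality is for
  blocks on which a nonzero vector may vanish.\<close>

lemma binary_quadratic_form_pos:
  fixes p r s x y :: real
  assumes "0 < p" "s\<^sup>2 < p * r"
  shows "0 \<le> p * x\<^sup>2 + 2 * s * x * y + r * y\<^sup>2"
    and "x \<noteq> 0 \<or> y \<noteq> 0 \<Longrightarrow> 0 < p * x\<^sup>2 + 2 * s * x * y + r * y\<^sup>2"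
proof -
  have eq: "p * (p * x\<^sup>2 + 2 * s * x * y + r * y\<^sup>2) = (p * x + s * y)\<^sup>2 + (p * r - s\<^sup>2) * y\<^sup>2"
    by (simp add: power2_eq_square algebra_simps)
  have "0 \<le> p * (p * x\<^sup>2 + 2 * s * x * y + r * y\<^sup>2)"
    unfolding eq using assms by simp
  thus "0 \<le> p * x\<^sup>2 + 2 * s * x * y + r * y\<^sup>2"
    using assms by (simp add: zero_le_mult_iff)
  assume xy: "x \<noteq> 0 \<or> y \<noteq> 0"
  have "0 < p * (p * x\<^sup>2 + 2 * s * x * y + r * y\<^sup>2)"
  proof (cases "y = 0")
    case True
    thus ?thesis unfolding eq using assms xy by simp
  next
    case False
    thus ?thesis unfolding eq using assms by (simp add: add_nonneg_pos)
  qed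
  thus "0 < p * x\<^sup>2 + 2 * s * x * y + r * y\<^sup>2"
    using assms by (simp add: zero_less_mult_iff)
qed

lemma mass_Q_form_row:
  fixes u :: "real ^ mode" and q\<^sub>0 q\<^sub>1 :: real
  defines "w \<equiv> (mass_matrix + Q_form q\<^sub>0 q\<^sub>1) *v u"
  shows "w $ Mode (0,0) = 4 * u $ Mode (0,0)"
    "w $ Mode (0,1) = 4/3 * u $ Mode (0,1) - 3 * q\<^sub>1 * u $ Mode (2,1)"
    "w $ Mode (0,2) = 4/5 * u $ Mode (0,2) + 9 * q\<^sub>1 * u $ Mode (2,0)"
    "w $ Mode (1,0) = 4/3 * u $ Mode (1,0) - 3 * q\<^sub>1 * u $ Mode (1,2)"
    "w $ Mode (1,1) = (4/9 + q\<^sub>1) * u $ Mode (1,1)"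
    "w $ Mode (1,2) = (4/15 + q\<^sub>0) * u $ Mode (1,2) - 3 * q\<^sub>1 * u $ Mode (1,0)"
    "w $ Mode (2,0) = 4/5 * u $ Mode (2,0) + 9 * q\<^sub>1 * u $ Mode (0,2)"
    "w $ Mode (2,1) = (4/15 + q\<^sub>0) * u $ Mode (2,1) - 3 * q\<^sub>1 * u $ Mode (0,1)"
  unfolding w_def
  by (simp_all add: matrix_vector_mult_def sum_mode mass_matrix_eq Q_form_def doubleton_eq_iff)

text \<open>Each bracket is one block, in the shape treated by
  \<open>binary_quadratic_form_pos\<close>.\<close>

lemma mass_Q_form_quadratic:
  "u \<bullet> ((mass_matrix + Q_form q\<^sub>0 q\<^sub>1) *v u) =
     4 * (u $ Mode (0,0))\<^sup>2
     + (4/3 * (u $ Mode (0,1))\<^sup>2 + 2 * (-3 * q\<^sub>1) * u $ Mode (0,1) * u $ Mode (2,1)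
        + (4/15 + q\<^sub>0) * (u $ Mode (2,1))\<^sup>2)
     + (4/3 * (u $ Mode (1,0))\<^sup>2 + 2 * (-3 * q\<^sub>1) * u $ Mode (1,0) * u $ Mode (1,2)
        + (4/15 + q\<^sub>0) * (u $ Mode (1,2))\<^sup>2)
     + (4/5 * (u $ Mode (0,2))\<^sup>2 + 2 * (9 * q\<^sub>1) * u $ Mode (0,2) * u $ Mode (2,0)
        + 4/5 * (u $ Mode (2,0))\<^sup>2)
     + (4/9 + q\<^sub>1) * (u $ Mode (1,1))\<^sup>2"
  unfolding inner_vec_def sum_mode mass_Q_form_row inner_real_def
  by (simp add: power2_eq_square algebra_simps)

lemma positive_definite_mass_Q_form_iff:
  "positive_definite (mass_matrix + Q_form q\<^sub>0 q\<^sub>1)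
     \<longleftrightarrow> 60 * q\<^sub>0 - 405 * q\<^sub>1\<^sup>2 > -16 \<and> 2025 * q\<^sub>1\<^sup>2 < 16"
proof
  assume "positive_definite (mass_matrix + Q_form q\<^sub>0 q\<^sub>1)"
  hence pos: "0 < u \<bullet> ((mass_matrix + Q_form q\<^sub>0 q\<^sub>1) *v u)" if "u $ a \<noteq> 0" for u a
    using that unfolding positive_definite_def by (metis zero_index)
  \<comment> \<open>a multiple of the minimiser of the (0,1)-(2,1) block for a fixed (2,1) component\<close>
  define u :: "real ^ mode" where
    "u = (\<chi> a. if degrees a = (0,1) then 9 * q\<^sub>1 else if degrees a = (2,1) then 4 else 0)"
  have "0 < 4/3 * (9 * q\<^sub>1)\<^sup>2 + 2 * (-3 * q\<^sub>1) * (9 * q\<^sub>1) * 4 + (4/15 + q\<^sub>0) * 4\<^sup>2"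
    using pos[of u "Mode (2,1)"] unfolding mass_Q_form_quadratic by (simp add: u_def)
  \<comment> \<open>The value of the form at \<open>u\<close> is 4/15 times
    \<open>60 * q\<^sub>0 - 405 * q\<^sub>1\<^sup>2 + 16\<close>.\<close>
  hence 1: "60 * q\<^sub>0 - 405 * q\<^sub>1\<^sup>2 > -16"
    by (simp add: power2_eq_square algebra_simps)
  \<comment> \<open>The (0,2)-(2,0) block has equal diagonal entries, so its eigenvectors are (1,1)
    and (1,-1); hence the choices t = 1 and t = -1.\<close>
  define v :: "real \<Rightarrow> real ^ mode" where
    "v t = (\<chi> a. if degrees a = (0,2) then 1 else if degrees a = (2,0) then t else 0)" for t
  have "0 < 4/5 + 18 * q\<^sub>1 * t + 4/5 * t\<^sup>2" for t
    using pos[of "v t" "Mode (0,2)"] unfolding mass_Q_form_quadratic by (simp add: v_def)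
  from this[of 1] this[of "-1"] have "\<bar>45 * q\<^sub>1\<bar> < 4"
    by (simp add: abs_less_iff)
  hence "(45 * q\<^sub>1)\<^sup>2 < 4\<^sup>2"
    using abs_le_square_iff[of 4 "45 * q\<^sub>1"] by linarith
  with 1 show "60 * q\<^sub>0 - 405 * q\<^sub>1\<^sup>2 > -16 \<and> 2025 * q\<^sub>1\<^sup>2 < 16"
    by (simp add: power_mult_distrib)
next
  assume asm: "60 * q\<^sub>0 - 405 * q\<^sub>1\<^sup>2 > -16 \<and> 2025 * q\<^sub>1\<^sup>2 < 16"
  hence "(45 * q\<^sub>1)\<^sup>2 < 4\<^sup>2"
    by (simp add: power_mult_distrib)
  hence "\<bar>45 * q\<^sub>1\<bar> < 4"
    using abs_le_square_iff[of 4 "45 * q\<^sub>1"] by linarith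
  \<comment> \<open>The lower bound -4/45 for \<open>q\<^sub>1\<close> exceeds -4/9.\<close>
  hence e: "0 < 4/9 + q\<^sub>1" by linarith
  \<comment> \<open>The determinants of the 2 by 2 blocks are positive: multiplied by 45 and 25,
    these inequalities are the two assumed ones.\<close>
  have b: "(-3 * q\<^sub>1)\<^sup>2 < 4/3 * (4/15 + q\<^sub>0)" and c: "(9 * q\<^sub>1)\<^sup>2 < 4/5 * (4/5)"
    using asm by (simp_all add: power_mult_distrib)
  have "0 < u \<bullet> ((mass_matrix + Q_form q\<^sub>0 q\<^sub>1) *v u)" if "u \<noteq> 0" for u
  proof -
    have ne: "\<not> (\<forall>a. u $ a = 0)"
      using that by (simp add: vec_eq_iff)
    have "0 \<le> 4 * (u $ Mode (0,0))\<^sup>2" "0 \<le> (4/9 + q\<^sub>1) * (u $ Mode (1,1))\<^sup>2"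
      "u $ Mode (0,0) \<noteq> 0 \<Longrightarrow> 0 < 4 * (u $ Mode (0,0))\<^sup>2"
      "u $ Mode (1,1) \<noteq> 0 \<Longrightarrow> 0 < (4/9 + q\<^sub>1) * (u $ Mode (1,1))\<^sup>2"
      using e by simp_all
    \<comment> \<open>All five groups of summands are nonnegative, and one that contains a nonzero
      component of \<open>u\<close> is positive.\<close>
    with ne show ?thesis
      unfolding mass_Q_form_quadratic all_mode
      using binary_quadratic_form_pos[OF _ b, of "u $ Mode (0,1)" "u $ Mode (2,1)"]
        binary_quadratic_form_pos[OF _ b, of "u $ Mode (1,0)" "u $ Mode (1,2)"]
        binary_quadratic_form_pos[OF _ c, of "u $ Mode (0,2)" "u $ Mode (2,0)"]
      by argo
  qed
  moreover have "transpose (mass_matrix + Q_form q\<^sub>0 q\<^sub>1) = mass_matrix + Q_form q\<^sub>0 q\<^sub>1"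
    by (auto simp: vec_eq_iff transpose_def mass_matrix_eq Q_form_def insert_commute)
  ultimately show "positive_definite (mass_matrix + Q_form q\<^sub>0 q\<^sub>1)"
    unfolding positive_definite_def by blast
qed

theorem mainTheorem7:
  shows "(\<forall>Q :: real ^ mode ^ mode.
            Q = transpose Q \<and>
            Q ** D_x = - transpose (Q ** D_x) \<and>
            Q ** D_y = - transpose (Q ** D_y) \<and>
            (\<forall>j :: int. T_rot (of_int j * (pi / 2)) ** Q = Q ** T_rot (of_int j * (pi / 2)))
            \<longleftrightarrow> (\<exists>q\<^sub>0 q\<^sub>1. Q = Q_form q\<^sub>0 q\<^sub>1))
       \<and> (\<forall>q\<^sub>0 q\<^sub>1. positive_definite (mass_matrix + Q_form q\<^sub>0 q\<^sub>1)
            \<longleftrightarrow> 60 * q\<^sub>0 - 405 * q\<^sub>1\<^sup>2 > -16 \<and> 2025 * q\<^sub>1\<^sup>2 < 16)"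
proof (intro conjI allI iffI; (elim conjE)?)
  fix Q :: "real ^ mode ^ mode"
  assume "Q = transpose Q" "Q ** D_x = - transpose (Q ** D_x)" "Q ** D_y = - transpose (Q ** D_y)"
    and T: "\<forall>j :: int. T_rot (of_int j * (pi / 2)) ** Q = Q ** T_rot (of_int j * (pi / 2))"
  moreover have "T_rot (pi / 2) ** Q = Q ** T_rot (pi / 2)"
    using T[rule_format, of 1] by simp
  ultimately show "\<exists>q\<^sub>0 q\<^sub>1. Q = Q_form q\<^sub>0 q\<^sub>1" by (intro ex_Q_form)
qed (use Q_form_conditions T_rot_commute_all positive_definite_mass_Q_form_iff in blast)+

end
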